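(* Let $0<\epsilon<1$, let $p=p(n)$ satisfy $0 \le p(n) \le 1-\epsilon$ for all $n$, and let $r=r(n)$ be a positive integer. If $\frac{p(n)\sqrt{n}}{r(n)\log n} \to \infty$ as $n \to \infty$, then the probability that the random graph $G(n,p)$ fails to contain at least $r$ pairwise edge-disjoint Hamilton cycles is $(1-p)^{(1+o(1))n}$ as $n\to\infty$.
   Context: $G(n,p)$ is the Erdős–Rényi random graph on $n$ vertices in which each pair of vertices is an edge independently with probability $p$. *)

theory Defs
  imports Complex_Main
begin

text \<open>Simple graphs on the vertex set {0..<n}: a graph is its set of edges,
  each edge being a 2-element subset of {0..<n}.\<close>

definition all_edges :: "nat \<Rightarrow> nat set set" where
  "all_edges n = {e. e \<subseteq> {0..<n} \<and> card e = 2}"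

definition is_ham_cycle :: "nat \<Rightarrow> nat set set \<Rightarrow> bool" where
  "is_ham_cycle n H \<longleftrightarrow> n \<ge> 3 \<and>
     (\<exists>vs. distinct vs \<and> set vs = {0..<n} \<and>
        H = {{vs ! i, vs ! ((i + 1) mod n)} | i. i < n})"

definition has_r_edge_disjoint_ham :: "nat \<Rightarrow> nat \<Rightarrow> nat set set \<Rightarrow> bool" where
  "has_r_edge_disjoint_ham n r E \<longleftrightarrow>
     (\<exists>Hs :: nat \<Rightarrow> nat set set.
        (\<forall>i<r. is_ham_cycle n (Hs i) \<and> Hs i \<subseteq> E) \<and>
        (\<forall>i<r. \<forall>j<r. i \<noteq> j \<longrightarrow> Hs i \<inter> Hs j = {}))"

definition gnp_prob :: "nat \<Rightarrow> real \<Rightarrow> (nat set set \<Rightarrow> bool) \<Rightarrow> real" where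
  "gnp_prob n p Q =
     (\<Sum>E\<in>{E. E \<subseteq> all_edges n \<and> Q E}.
        p ^ card E * (1 - p) ^ (card (all_edges n) - card E))"

end

theory Submission
  imports Defs
begin

text \<open>Let \<open>k \<approx> 3\<surd>n\<close>. Suppose that every \<open>k\<close>-set spans at least \<open>2rk\<close> edges, and that any disjoint
  nonempty \<open>A\<close>, \<open>B\<close> with \<open>|A| \<le> |B|\<close> missing fewer than \<open>k\<close> vertices have at least \<open>2r|A|\<close> edges between
  them. A Hamilton cycle has at most \<open>2|A|\<close> edges meeting a set \<open>A\<close>, so after deleting fewer than \<open>r\<close>
  Hamilton cycles the rest has no independent \<open>k\<close>-set and is \<open>k\<close>-connected, and therefore it is
  Hamiltonian by Chvatal and Erdos: a component \<open>U\<close> of the complement of a longest cycle has at least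
  \<open>k\<close> neighbours on it, and two adjacent successors of such neighbours allow a detour through \<open>U\<close>.

  The probability that the hypothesis fails is estimated by the union bound. Fewer than \<open>m\<close> of \<open>t\<close>
  given pairs are edges with probability at most \<open>(t+1)^m (1-p)^(t-m)\<close>. As \<open>r log n = o(p \<surd>n)\<close>, all
  counting factors are absorbed, and the dominating term is \<open>|A| = 1\<close>, which gives \<open>(1-p)^((1-o(1))n)\<close>.
  A matching lower bound is the probability that a fixed vertex is isolated.\<close>

subsection \<open>Hamilton cycles from connectivity and independence\<close>

text \<open>Deliberately, a single edge counts as a cycle, represented by a list of length 2: it is the
  starting point for growing longer cycles.\<close>

definition cycle_list :: "'a set set \<Rightarrow> 'a list \<Rightarrow> bool" where
  "cycle_list E xs \<longleftrightarrow> xs \<noteq> [] \<and> distinct xs \<and>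
     successively (\<lambda>x y. {x, y} \<in> E) xs \<and> {last xs, hd xs} \<in> E"

section \<open>Rotating, extending and rerouting cycles\<close>

lemma cycle_list_rotate:
  assumes "cycle_list E xs"
  shows "cycle_list E (rotate m xs)"
proof (induction m)
  case 0
  then show ?case using assms by simp
next
  case (Suc m)
  then obtain y ys where "rotate m xs = y # ys" "cycle_list E (y # ys)"
    by (metis cycle_list_def list.exhaust)
  then show ?case
    by (cases "ys = []")
       (auto simp: cycle_list_def rotate1_hd_tl successively_append_iff successively_Cons)
qed

lemma cycle_list_append:
  assumes "cycle_list E xs" "distinct P" "P \<noteq> []" "set P \<inter> set xs = {}"
    and "successively (\<lambda>x y. {x, y} \<in> E) P" "{last xs, hd P} \<in> E" "{last P, hd xs} \<in> E"
  shows "cycle_list E (xs @ P)"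
  using assms by (auto simp: cycle_list_def successively_append_iff)

text \<open>The edges from \<open>last as\<close> to \<open>hd bs\<close> and from
  \<open>last bs\<close> to \<open>hd as\<close> are dropped. The new cycle runs backwards through
  \<open>as\<close>, takes the chord from \<open>hd as\<close> to \<open>hd bs\<close>, follows
  \<open>bs\<close> forwards and returns to \<open>last as\<close> through \<open>P\<close>.\<close>

lemma cycle_list_reroute:
  assumes "cycle_list E (as @ bs)" "as \<noteq> []" "bs \<noteq> []" "{hd as, hd bs} \<in> E"
    and "distinct P" "P \<noteq> []" "set P \<inter> set (as @ bs) = {}"
    and "successively (\<lambda>x y. {x, y} \<in> E) P" "{last bs, hd P} \<in> E" "{last P, last as} \<in> E"
  shows "cycle_list E (rev as @ bs @ P)"
  using assms
  by (auto simp: cycle_list_def successively_append_iff hd_rev last_rev insert_commute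
           simp del: successively_cong)

lemma cycle_list_is_ham_cycle:
  assumes "cycle_list E xs" "set xs = {0..<n}" "n \<ge> 3"
  shows "\<exists>H\<subseteq>E. is_ham_cycle n H"
proof -
  have ne: "xs \<noteq> []" and "distinct xs" using assms(1) by (auto simp: cycle_list_def)
  then have len: "length xs = n" using assms(2) distinct_card by force
  have "{xs ! i, xs ! ((i + 1) mod n)} \<in> E" if "i < n" for i
  proof (cases "i + 1 = n")
    case True
    then have "xs ! i = last xs" "xs ! ((i + 1) mod n) = hd xs"
      using len ne by (auto simp: last_conv_nth hd_conv_nth)
    then show ?thesis using assms(1) by (simp add: cycle_list_def)
  next
    case False
    then show ?thesis using assms(1) len that by (simp add: cycle_list_def successively_conv_nth)
  qed
  then have "{{xs ! i, xs ! ((i + 1) mod n)} | i. i < n} \<subseteq> E" by auto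
  moreover have "is_ham_cycle n {{xs ! i, xs ! ((i + 1) mod n)} | i. i < n}"
    using assms by (auto simp: is_ham_cycle_def cycle_list_def)
  ultimately show ?thesis by blast
qed

lemma rtrancl_distinct_path:
  assumes "(x, y) \<in> R\<^sup>*" "x \<in> W" "R \<subseteq> W \<times> W"
  shows "\<exists>P. P \<noteq> [] \<and> distinct P \<and> set P \<subseteq> W \<and> successively (\<lambda>a b. (a, b) \<in> R) P \<and> hd P = x \<and> last P = y"
  using assms
proof (induction rule: converse_rtrancl_induct)
  case base
  then show ?case by (intro exI[of _ "[y]"]) auto
next
  case (step x z)
  then obtain P where P: "P \<noteq> []" "distinct P" "set P \<subseteq> W" "successively (\<lambda>a b. (a, b) \<in> R) P"
    "hd P = z" "last P = y" by blast
  show ?case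
  proof (cases "x \<in> set P")
    case True
    \<comment> \<open>When \<open>x\<close> already lies on \<open>P\<close>, the part before it is
      a loop and is cut off, which keeps the path distinct.\<close>
    then obtain us vs where "P = us @ x # vs" by (meson split_list)
    then show ?thesis using P by (intro exI[of _ "x # vs"]) (auto simp: successively_append_iff)
  next
    case False
    then show ?thesis using P step by (intro exI[of _ "x # P"]) (auto simp: successively_Cons)
  qed
qed

section \<open>The Chvatal-Erdos theorem\<close>

text \<open>\<open>indep\<close> says that the independence number is below \<open>k\<close>.
  \<open>conn\<close> is \<open>k\<close>-connectivity in separator form: the vertices outside
  \<open>A\<close> and \<open>B\<close> number fewer than \<open>k\<close>, so they cannot separate
  \<open>A\<close> from \<open>B\<close>. A longest cycle that misses a vertex can then be
  lengthened.\<close>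

lemma ham_cycle_of_connected_and_no_independent:
  assumes E: "E \<subseteq> all_edges n" and n: "n \<ge> 3" and k: "k \<ge> 1"
    and indep: "\<And>K. K \<subseteq> {0..<n} \<Longrightarrow> card K = k \<Longrightarrow> \<exists>e\<in>E. e \<subseteq> K"
    and conn: "\<And>A B. A \<union> B \<subseteq> {0..<n} \<Longrightarrow> A \<inter> B = {} \<Longrightarrow> A \<noteq> {} \<Longrightarrow> B \<noteq> {} \<Longrightarrow>
                 n < card A + card B + k \<Longrightarrow> \<exists>a\<in>A. \<exists>b\<in>B. {a, b} \<in> E"
  shows "\<exists>H\<subseteq>E. is_ham_cycle n H"
proof -
  have edge: "x < n \<and> y < n \<and> x \<noteq> y" if "{x, y} \<in> E" for x y
  proof -
    have "{x, y} \<subseteq> {0..<n} \<and> card {x, y} = 2"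
      using that E unfolding all_edges_def by blast
    then show ?thesis by (cases "x = y") auto
  qed
  have cyc_sub: "set xs \<subseteq> {0..<n}" if "cycle_list E xs" for xs
  proof
    fix x assume "x \<in> set xs"
    then obtain i where i: "i < length xs" "x = xs ! i" by (auto simp: in_set_conv_nth)
    show "x \<in> {0..<n}"
    proof (cases "Suc i < length xs")
      case True
      then have "{xs ! i, xs ! Suc i} \<in> E"
        using that by (simp add: cycle_list_def successively_conv_nth)
      then show ?thesis using edge i by auto
    next
      case False
      then have "i = length xs - 1" using i by auto
      then have "x = last xs" using i that by (simp add: cycle_list_def last_conv_nth)
      then show ?thesis using that edge by (auto simp: cycle_list_def)
    qed
  qed
  have cyc_len: "length xs \<le> n" if "cycle_list E xs" for xs
    using cyc_sub[OF that] that card_mono[of "{0..<n}" "set xs"] distinct_card[of xs]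
    by (auto simp: cycle_list_def)
  \<comment> \<open>These two sets miss no vertex, so \<open>k \<ge> 1\<close> suffices; the edge
    obtained is the cycle of length 2 from which a longest one exists.\<close>
  have "\<exists>a\<in>{0}. \<exists>b\<in>{1..<n}. {a, b} \<in> E"
    using n k by (intro conn) auto
  then obtain b where "{0, b} \<in> E" by auto
  then have "cycle_list E [0, b]" using edge by (auto simp: cycle_list_def insert_commute)
  then obtain xs where xs: "cycle_list E xs"
    and longest: "\<And>ys. cycle_list E ys \<Longrightarrow> length ys \<le> length xs"
    using cyc_len ex_has_greatest_nat[of "cycle_list E" "[0, b]" length "Suc n"] by (auto simp: less_Suc_eq_le)
  define l where "l = length xs"
  have xs': "xs \<noteq> []" "distinct xs" "l > 0" using xs by (auto simp: cycle_list_def l_def)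
  show ?thesis
  proof (cases "set xs = {0..<n}")
    case True
    then show ?thesis using cycle_list_is_ham_cycle xs n by blast
  next
    case False
    define W where "W = {0..<n} - set xs"
    obtain v where v: "v \<in> W" using False cyc_sub[OF xs] unfolding W_def by blast
    define R where "R = {(x, y). x \<in> W \<and> y \<in> W \<and> {x, y} \<in> E}"
    have RW: "R \<subseteq> W \<times> W" by (auto simp: R_def)
    have "sym R" by (auto simp: R_def sym_def insert_commute)
    \<comment> \<open>\<open>U\<close> is the component of \<open>v\<close> in the graph induced on
      the vertices off the cycle.\<close>
    define U where "U = R\<^sup>* `` {v}"
    have UW: "U \<subseteq> W"
    proof
      fix w assume "w \<in> U"
      then have "(v, w) \<in> R\<^sup>*" by (simp add: U_def)
      then show "w \<in> W" by (cases rule: rtranclE) (use v RW in auto)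
    qed
    have path: "\<exists>P. P \<noteq> [] \<and> distinct P \<and> set P \<inter> set xs = {} \<and>
        successively (\<lambda>a b. {a, b} \<in> E) P \<and> hd P = x \<and> last P = y" if "x \<in> U" "y \<in> U" for x y
    proof -
      have "(v, x) \<in> R\<^sup>*" "(v, y) \<in> R\<^sup>*" using that by (auto simp: U_def)
      then have "(x, y) \<in> R\<^sup>*"
        using symD[OF sym_rtrancl[OF \<open>sym R\<close>], of v x] rtrancl_trans[of x v R y] by simp
      moreover have "x \<in> W" using that UW by auto
      ultimately obtain P where P: "P \<noteq> []" "distinct P" "set P \<subseteq> W"
        "successively (\<lambda>a b. (a, b) \<in> R) P" "hd P = x" "last P = y"
        using rtrancl_distinct_path[OF _ _ RW] by metis
      moreover have "successively (\<lambda>a b. {a, b} \<in> E) P"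
        using P(4) by (rule successively_mono) (auto simp: R_def)
      ultimately show ?thesis by (intro exI[of _ P]) (auto simp: W_def)
    qed
    \<comment> \<open>\<open>S\<close> consists of the neighbours of \<open>U\<close> on the cycle;
      it separates \<open>U\<close> from all remaining vertices \<open>B\<close>.\<close>
    define S where "S = {x \<in> set xs. \<exists>u\<in>U. {x, u} \<in> E}"
    have S: "S \<subseteq> set xs" "finite S" by (auto simp: S_def)
    define B where "B = {0..<n} - U - S"
    have noedge: "{u, w} \<notin> E" if "u \<in> U" "w \<in> B" for u w
    proof
      assume "{u, w} \<in> E"
      show False
      proof (cases "w \<in> set xs")
        case True
        then show False using that \<open>{u, w} \<in> E\<close> by (auto simp: B_def S_def insert_commute)
      next
        case False
        then have "(u, w) \<in> R" using that \<open>{u, w} \<in> E\<close> UW by (auto simp: R_def B_def W_def)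
        then have "w \<in> U"
          using that rtrancl_into_rtrancl[of v u R w] by (simp add: U_def)
        then show False using that by (auto simp: B_def)
      qed
    qed
    \<comment> \<open>Rotating by \<open>Suc i\<close> opens the cycle right after
      \<open>xs ! i\<close>: its successor comes first and \<open>xs ! i\<close> itself comes
      last.\<close>
    have rot: "cycle_list E (rotate (Suc i) xs)" "hd (rotate (Suc i) xs) = xs ! (Suc i mod l)"
      "last (rotate (Suc i) xs) = xs ! i" if "i < l" for i
    proof -
      show "cycle_list E (rotate (Suc i) xs)" by (rule cycle_list_rotate[OF xs])
      show "hd (rotate (Suc i) xs) = xs ! (Suc i mod l)"
        using hd_rotate_conv_nth xs' l_def by blast
      have "(Suc i + (l - 1)) mod l = i" using that by simp
      then show "last (rotate (Suc i) xs) = xs ! i"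
        using xs' nth_rotate[of "l - 1" xs "Suc i"]
        by (simp add: last_conv_nth l_def[symmetric] del: rotate_Suc)
    qed
    show ?thesis
    proof (cases "k \<le> card S")
      case True
      define I where "I = {i. i < l \<and> xs ! i \<in> S}"
      \<comment> \<open>\<open>f\<close> sends an index to the successor on the cycle. It is
        injective on \<open>I\<close>, so \<open>U\<close> has at least \<open>k\<close> successors
        of neighbours, and two of them are adjacent.\<close>
      define f where "f = (\<lambda>i. xs ! (Suc i mod l))"
      have "(!) xs ` I = S" using S by (auto simp: I_def image_iff l_def in_set_conv_nth subset_iff)
      then have "card S \<le> card I" using card_image_le[of I "(!) xs"] by (auto simp: I_def)
      have modinj: "i = j" if "Suc i mod l = Suc j mod l" "i < l" "j < l" for i j
        using that by (auto simp: mod_Suc split: if_splits)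
      have "inj_on f I"
      proof (rule inj_onI)
        fix i j assume ij: "i \<in> I" "j \<in> I" "f i = f j"
        have "Suc i mod l = Suc j mod l"
          using ij(3) nth_eq_iff_index_eq[OF xs'(2), of "Suc i mod l" "Suc j mod l"] xs'(3)
          unfolding f_def l_def by simp
        then show "i = j" using modinj ij(1,2) unfolding I_def by blast
      qed
      then have "card (f ` I) = card I" by (rule card_image)
      then have "k \<le> card (f ` I)" using \<open>card S \<le> card I\<close> True by linarith
      then obtain K where K: "K \<subseteq> f ` I" "card K = k"
        using obtain_subset_with_card_n[of k "f ` I"] by metis
      have "f ` I \<subseteq> set xs" using xs' by (auto simp: f_def l_def)
      then obtain e where e: "e \<in> E" "e \<subseteq> K"
        using indep[of K] K cyc_sub[OF xs] by (metis subset_trans)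
      then have "card e = 2" using E by (auto simp: all_edges_def)
      then obtain a b where ab: "e = {a, b}" "a \<noteq> b" by (auto simp: card_2_iff)
      then have "a \<in> f ` I" "b \<in> f ` I" using e K by auto
      then obtain i j where i: "i \<in> I" "a = f i" and j: "j \<in> I" "b = f j" by blast
      have "i \<noteq> j" using i j ab by auto
      have il: "i < l" "j < l" using i j by (auto simp: I_def)
      \<comment> \<open>The cyclic distance from \<open>i\<close> to \<open>j\<close>; adding
        \<open>l\<close> avoids truncated subtraction. Once the cycle is opened after
        \<open>xs ! i\<close>, the vertex \<open>b\<close> has index \<open>d\<close> and
        \<open>xs ! j\<close> has index \<open>d - 1\<close>.\<close>
      define d where "d = (j + l - i) mod l"
      have "i + (j + l - i) = j + l" using il by simp
      then have "(i + d) mod l = (j + l) mod l" by (metis d_def mod_add_right_eq)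
      then have id: "(i + d) mod l = j" using il by simp
      then have "d \<noteq> 0" using il \<open>i \<noteq> j\<close> by (metis add_0_right mod_less)
      have dl: "d < l" using xs' by (simp add: d_def)
      define ys where "ys = rotate (Suc i) xs"
      have lys: "length ys = l" "ys \<noteq> []" using xs' by (auto simp: ys_def l_def)
      have ysd: "ys ! d = b"
      proof -
        have "ys ! d = xs ! ((Suc i + d) mod l)"
          unfolding ys_def l_def using dl l_def by (intro nth_rotate) auto
        also have "(Suc i + d) mod l = Suc ((i + d) mod l) mod l" by (simp add: mod_Suc_eq)
        also have "\<dots> = Suc j mod l" by (simp add: id)
        finally show ?thesis by (simp add: j f_def)
      qed
      have ysd': "ys ! (d - 1) = xs ! j"
      proof -
        have "ys ! (d - 1) = xs ! ((Suc i + (d - 1)) mod l)"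
          unfolding ys_def l_def using dl l_def by (intro nth_rotate) auto
        also have "Suc i + (d - 1) = i + d" using \<open>d \<noteq> 0\<close> by simp
        finally show ?thesis by (simp add: id)
      qed
      \<comment> \<open>Now \<open>as\<close> runs from \<open>a\<close> to \<open>xs ! j\<close>
        and \<open>bs\<close> from \<open>b\<close> to \<open>xs ! i\<close>. The chord
        \<open>{a, b}\<close> and a path through \<open>U\<close> from a neighbour of
        \<open>xs ! i\<close> to one of \<open>xs ! j\<close> give the detour, longer by
        \<open>length P\<close>.\<close>
      define as bs where "as = take d ys" and "bs = drop d ys"
      have asbs: "as @ bs = ys" "as \<noteq> []" "bs \<noteq> []"
        using \<open>d \<noteq> 0\<close> dl lys by (auto simp: as_def bs_def)
      have "hd as = a" using rot(2)[OF il(1)] \<open>d \<noteq> 0\<close> by (simp add: as_def ys_def i f_def)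
      moreover have "hd bs = b" using ysd dl lys by (simp add: bs_def hd_drop_conv_nth)
      moreover have "last as = xs ! j"
        using ysd' dl lys asbs by (simp add: as_def last_conv_nth)
      moreover have "last bs = xs ! i"
        using rot(3)[OF il(1)] asbs by (metis last_appendR ys_def)
      moreover obtain u w where u: "u \<in> U" "{xs ! i, u} \<in> E" and w: "w \<in> U" "{xs ! j, w} \<in> E"
        using i j by (auto simp: I_def S_def)
      moreover obtain P where P: "P \<noteq> []" "distinct P" "set P \<inter> set xs = {}"
        "successively (\<lambda>a b. {a, b} \<in> E) P" "hd P = u" "last P = w"
        using path[OF u(1) w(1)] by metis
      ultimately have "cycle_list E (rev as @ bs @ P)"
        using rot(1)[OF il(1)] asbs ab e
        by (intro cycle_list_reroute) (auto simp: ys_def insert_commute)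
      then have "length (rev as @ bs @ P) \<le> l" unfolding l_def by (rule longest)
      moreover have "length as + length bs = l" using asbs lys by (metis length_append)
      ultimately have "length P = 0" unfolding length_append length_rev by linarith
      then show ?thesis using \<open>P \<noteq> []\<close> by simp
    next
      case False
      \<comment> \<open>With fewer than \<open>k\<close> vertices, \<open>S\<close> cannot separate
        \<open>U\<close> from a nonempty \<open>B\<close>. Hence every cycle vertex has a neighbour
        in \<open>U\<close>, and a path through \<open>U\<close> fits between any two consecutive
        ones.\<close>
      have "B = {}"
      proof (rule ccontr)
        assume "B \<noteq> {}"
        have dis: "U \<subseteq> {0..<n}" "S \<subseteq> {0..<n}" "U \<inter> S = {}"
          using UW S cyc_sub[OF xs] by (auto simp: W_def)
        moreover have "B = {0..<n} - (U \<union> S)" by (auto simp: B_def)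
        ultimately have "card B = n - (card U + card S)"
          by (simp add: card_Diff_subset card_Un_disjoint finite_subset[of _ "{0..<n}"])
        then have "n < card U + card B + k" using False by simp
        moreover have "v \<in> U" by (auto simp: U_def)
        ultimately have "\<exists>a\<in>U. \<exists>b\<in>B. {a, b} \<in> E"
          using \<open>B \<noteq> {}\<close> dis by (intro conn) (auto simp: B_def)
        then show False using noedge by blast
      qed
      then have "set xs \<subseteq> S" using UW cyc_sub[OF xs] by (auto simp: B_def W_def)
      then have inS: "xs ! i \<in> S" if "i < l" for i using that by (auto simp: l_def)
      have "l > 0" by fact
      let ?ys = "rotate (Suc 0) xs"
      have "hd ?ys \<in> S" "last ?ys \<in> S" using rot[OF \<open>l > 0\<close>] inS \<open>l > 0\<close> by auto
      then obtain u w where u: "u \<in> U" "{last ?ys, u} \<in> E" and w: "w \<in> U" "{hd ?ys, w} \<in> E"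
        by (auto simp: S_def)
      obtain P where P: "P \<noteq> []" "distinct P" "set P \<inter> set xs = {}"
        "successively (\<lambda>a b. {a, b} \<in> E) P" "hd P = u" "last P = w"
        using path[OF u(1) w(1)] by metis
      have "cycle_list E (?ys @ P)"
        using P u w rot(1)[OF \<open>l > 0\<close>] by (intro cycle_list_append) (auto simp: insert_commute)
      then have "length (?ys @ P) \<le> l" unfolding l_def by (rule longest)
      then show ?thesis using \<open>P \<noteq> []\<close> by (simp add: l_def)
    qed
  qed
qed

section \<open>Extracting edge-disjoint Hamilton cycles one at a time\<close>

lemma ham_cycle_card_incident:
  assumes "is_ham_cycle n H" "finite A"
  shows "card {e \<in> H. e \<inter> A \<noteq> {}} \<le> 2 * card A"
proof -
  obtain vs where vs: "distinct vs" "set vs = {0..<n}" "n \<ge> 3"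
    and H: "H = {{vs ! i, vs ! ((i + 1) mod n)} | i. i < n}"
    using assms by (auto simp: is_ham_cycle_def)
  have len: "length vs = n" using vs distinct_card by fastforce
  \<comment> \<open>Edge number \<open>i\<close> joins positions \<open>i\<close> and
    \<open>Suc i mod n\<close>. \<open>I\<close> and \<open>J\<close> collect the edges whose first,
    respectively second, endpoint is in \<open>A\<close>; each vertex of \<open>A\<close> accounts
    for at most one index in each.\<close>
  define I where "I = {i. i < n \<and> vs ! i \<in> A}"
  define J where "J = {i. i < n \<and> vs ! (Suc i mod n) \<in> A}"
  have fin: "finite I" "finite J" by (auto simp: I_def J_def)
  have "card I \<le> card A"
    using vs len assms(2) by (intro card_inj_on_le[of "(!) vs"]) (auto simp: I_def inj_on_def nth_eq_iff_index_eq)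
  moreover have "card J \<le> card A"
  proof (rule card_inj_on_le[of "\<lambda>i. vs ! (Suc i mod n)"])
    show "inj_on (\<lambda>i. vs ! (Suc i mod n)) J"
      using vs len by (auto simp: J_def inj_on_def nth_eq_iff_index_eq mod_Suc split: if_splits)
  qed (auto simp: J_def assms)
  moreover have "{e \<in> H. e \<inter> A \<noteq> {}} \<subseteq> (\<lambda>i. {vs ! i, vs ! (Suc i mod n)}) ` (I \<union> J)"
    unfolding H I_def J_def by auto
  then have "card {e \<in> H. e \<inter> A \<noteq> {}} \<le> card (I \<union> J)" using fin by (meson finite_UnI surj_card_le)
  ultimately show ?thesis using card_Un_le[of I J] by linarith
qed

text \<open>Every element of \<open>T\<close> meets \<open>A\<close>, so the \<open>m\<close> cycles
  use at most \<open>2 * m * card A\<close> edges of \<open>T\<close>, fewer than the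
  \<open>2 * r * card A\<close> available.\<close>

lemma edge_avoiding_ham_cycles:
  assumes "\<And>i. i < m \<Longrightarrow> is_ham_cycle n (Hs i)" "finite A" "m < r" "A \<noteq> {}"
    and "2 * r * card A \<le> card (E \<inter> T)" "\<And>e. e \<in> T \<Longrightarrow> e \<inter> A \<noteq> {}"
  shows "\<exists>e\<in>T. e \<in> E - (\<Union>i<m. Hs i)"
proof (rule ccontr)
  assume "\<not> ?thesis"
  then have sub: "E \<inter> T \<subseteq> (\<Union>i<m. {e \<in> Hs i. e \<inter> A \<noteq> {}})" using assms(6) by fastforce
  have "finite (Hs i)" if "i < m" for i
    using assms(1)[OF that] by (auto simp: is_ham_cycle_def)
  then have "card (E \<inter> T) \<le> card (\<Union>i<m. {e \<in> Hs i. e \<inter> A \<noteq> {}})"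
    by (intro card_mono sub) auto
  also have "\<dots> \<le> (\<Sum>i<m. card {e \<in> Hs i. e \<inter> A \<noteq> {}})" by (rule card_UN_le) simp
  also have "\<dots> \<le> (\<Sum>i<m. 2 * card A)"
    using ham_cycle_card_incident assms by (intro sum_mono) auto
  also have "\<dots> = 2 * m * card A" by simp
  also have "\<dots> < 2 * r * card A" using assms by (auto simp: card_gt_0_iff)
  finally show False using assms by linarith
qed

definition edges_between :: "'a set \<Rightarrow> 'a set \<Rightarrow> 'a set set" where
  "edges_between A B = {{a, b} | a b. a \<in> A \<and> b \<in> B}"

lemma edges_between_conv_image: "edges_between A B = (\<lambda>(a, b). {a, b}) ` (A \<times> B)"
  by (auto simp: edges_between_def)

lemma card_edges_between:
  assumes "A \<inter> B = {}"
  shows "card (edges_between A B) = card A * card B"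
proof -
  have "inj_on (\<lambda>(a, b). {a, b}) (A \<times> B)"
    using assms by (auto simp: inj_on_def doubleton_eq_iff)
  then show ?thesis by (simp add: edges_between_conv_image card_image card_cartesian_product)
qed

lemma edges_between_subset:
  assumes "A \<union> B \<subseteq> {0..<n}" "A \<inter> B = {}"
  shows "edges_between A B \<subseteq> all_edges n"
  using assms by (auto simp: edges_between_def all_edges_def card_2_iff) blast

text \<open>Induction on the number of cycles found: after deleting \<open>m < r\<close> of them, an
  edge survives in each \<open>K\<close> and between each pair \<open>A\<close>, \<open>B\<close>,
  so the Chvatal-Erdos criterion applies again with the same \<open>k\<close>. The loss is charged
  to the smaller of the two sets, hence the assumption \<open>card A \<le> card B\<close>.\<close>

lemma edge_disjoint_ham_of_many_edges:
  assumes E: "E \<subseteq> all_edges n" and n: "n \<ge> 3" and k: "k \<ge> 1"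
    and indep: "\<And>K. K \<subseteq> {0..<n} \<Longrightarrow> card K = k \<Longrightarrow> 2 * r * k \<le> card (E \<inter> {e. e \<subseteq> K \<and> card e = 2})"
    and conn: "\<And>A B. A \<union> B \<subseteq> {0..<n} \<Longrightarrow> A \<inter> B = {} \<Longrightarrow> A \<noteq> {} \<Longrightarrow> card A \<le> card B \<Longrightarrow>
                 n < card A + card B + k \<Longrightarrow> 2 * r * card A \<le> card (E \<inter> edges_between A B)"
  shows "has_r_edge_disjoint_ham n r E"
proof -
  have "has_r_edge_disjoint_ham n m E" if "m \<le> r" for m
    using that
  proof (induction m)
    case 0
    then show ?case by (simp add: has_r_edge_disjoint_ham_def)
  next
    case (Suc m)
    then obtain Hs where Hs: "\<forall>i<m. is_ham_cycle n (Hs i) \<and> Hs i \<subseteq> E"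
      "\<forall>i<m. \<forall>j<m. i \<noteq> j \<longrightarrow> Hs i \<inter> Hs j = {}"
      by (auto simp: has_r_edge_disjoint_ham_def)
    let ?E = "E - (\<Union>i<m. Hs i)"
    have ordered: "\<exists>a\<in>A. \<exists>b\<in>B. {a, b} \<in> ?E"
      if "A \<union> B \<subseteq> {0..<n}" "A \<inter> B = {}" "A \<noteq> {}" "card A \<le> card B" "n < card A + card B + k" for A B
    proof -
      have "\<exists>e\<in>edges_between A B. e \<in> ?E"
        using Hs Suc.prems conn[OF that] that finite_subset[of A "{0..<n}"]
        by (intro edge_avoiding_ham_cycles[of m n Hs A r]) (auto simp: edges_between_def)
      then show ?thesis by (auto simp: edges_between_def)
    qed
    have "\<exists>H\<subseteq>?E. is_ham_cycle n H"
    proof (rule ham_cycle_of_connected_and_no_independent[OF _ n k])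
      show "?E \<subseteq> all_edges n" using E by auto
      fix K assume K: "K \<subseteq> {0..<n}" "card K = k"
      then have "K \<noteq> {}" "finite K" using k by (auto intro: finite_subset)
      then have "\<exists>e\<in>{e. e \<subseteq> K \<and> card e = 2}. e \<in> ?E"
        using Hs Suc.prems indep[OF K] K
        by (intro edge_avoiding_ham_cycles[of m n Hs K r]) (auto simp: Int_absorb2)
      then show "\<exists>e\<in>?E. e \<subseteq> K" by blast
    next
      fix A B assume *: "A \<union> B \<subseteq> {0..<n}" "A \<inter> B = {}" "A \<noteq> {}" "B \<noteq> {}" "n < card A + card B + k"
      show "\<exists>a\<in>A. \<exists>b\<in>B. {a, b} \<in> ?E"
      proof (cases "card A \<le> card B")
        case True
        then show ?thesis using ordered * by blast
      next
        case False
        then have "\<exists>b\<in>B. \<exists>a\<in>A. {b, a} \<in> ?E"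
          using * by (intro ordered) auto
        then show ?thesis by (metis insert_commute)
      qed
    qed
    then obtain H where H: "H \<subseteq> ?E" "is_ham_cycle n H" by blast
    show ?case unfolding has_r_edge_disjoint_ham_def
      using Hs H by (intro exI[of _ "Hs(m := H)"]) (auto simp: less_Suc_eq; blast)
  qed
  then show ?thesis by simp
qed

subsection \<open>Union bounds\<close>

lemma finite_all_edges [simp]: "finite (all_edges n)"
  unfolding all_edges_def by (rule finite_subset[of _ "Pow {0..<n}"]) auto

lemma card_all_edges: "card (all_edges n) = n choose 2"
  by (simp add: all_edges_def n_subsets)

lemma gnp_prob_mono:
  assumes "0 \<le> p" "p \<le> 1" "\<And>E. E \<subseteq> all_edges n \<Longrightarrow> P E \<Longrightarrow> Q E"
  shows "gnp_prob n p P \<le> gnp_prob n p Q"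
  unfolding gnp_prob_def using assms
  by (intro sum_mono2) (auto intro!: finite_subset[of _ "Pow (all_edges n)"])

lemma gnp_prob_disj_le:
  assumes "0 \<le> p" "p \<le> 1"
  shows "gnp_prob n p (\<lambda>E. P E \<or> Q E) \<le> gnp_prob n p P + gnp_prob n p Q"
proof -
  let ?w = "\<lambda>E. p ^ card E * (1 - p) ^ (card (all_edges n) - card E)"
  let ?A = "{E. E \<subseteq> all_edges n \<and> P E}" and ?B = "{E. E \<subseteq> all_edges n \<and> Q E}"
  have "finite ?A" "finite ?B" by (auto intro: finite_subset[of _ "Pow (all_edges n)"])
  then have "sum ?w (?A \<union> ?B) + sum ?w (?A \<inter> ?B) = sum ?w ?A + sum ?w ?B"
    by (rule sum.union_inter)
  moreover have "0 \<le> sum ?w (?A \<inter> ?B)" using assms by (intro sum_nonneg) auto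
  moreover have "{E. E \<subseteq> all_edges n \<and> (P E \<or> Q E)} = ?A \<union> ?B" by auto
  ultimately show ?thesis by (simp add: gnp_prob_def)
qed

lemma gnp_prob_Bex_le:
  assumes "0 \<le> p" "p \<le> 1" "finite I"
  shows "gnp_prob n p (\<lambda>E. \<exists>i\<in>I. Q i E) \<le> (\<Sum>i\<in>I. gnp_prob n p (Q i))"
  using assms(3)
proof (induction I rule: finite_induct)
  case empty
  then show ?case by (simp add: gnp_prob_def)
next
  case (insert j I)
  have "gnp_prob n p (\<lambda>E. \<exists>i\<in>insert j I. Q i E) = gnp_prob n p (\<lambda>E. Q j E \<or> (\<exists>i\<in>I. Q i E))"
    by simp
  also have "\<dots> \<le> gnp_prob n p (Q j) + gnp_prob n p (\<lambda>E. \<exists>i\<in>I. Q i E)"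
    using assms by (intro gnp_prob_disj_le)
  finally show ?case using insert by simp
qed

lemma gnp_prob_avoid:
  assumes "T \<subseteq> all_edges n"
  shows "gnp_prob n p (\<lambda>E. E \<inter> T = {}) = (1 - p) ^ card T"
proof -
  let ?U = "all_edges n"
  have fin: "finite T" "finite ?U" using finite_subset[OF assms] by auto
  have "{E. E \<subseteq> ?U \<and> E \<inter> T = {}} = Pow (?U - T)" using assms by auto
  then have "gnp_prob n p (\<lambda>E. E \<inter> T = {}) = (\<Sum>E\<in>Pow (?U - T). p ^ card E * (1 - p) ^ (card ?U - card E))"
    by (simp add: gnp_prob_def)
  also have "\<dots> = (\<Sum>E\<in>Pow (?U - T). (1 - p) ^ card T * ((\<Prod>e\<in>E. p) * (\<Prod>e\<in>(?U - T) - E. 1 - p)))"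
  proof (rule sum.cong[OF refl])
    fix E assume E: "E \<in> Pow (?U - T)"
    then have "finite E" using fin by (auto intro: finite_subset)
    then have "card ((?U - T) - E) = card ?U - card T - card E"
      using E fin assms by (simp add: card_Diff_subset)
    moreover have "card T + card E \<le> card ?U"
      using E fin assms \<open>finite E\<close> by (subst card_Un_disjoint[symmetric]) (auto intro!: card_mono)
    ultimately have "card ?U - card E = card T + card ((?U - T) - E)" by linarith
    then show "p ^ card E * (1 - p) ^ (card ?U - card E) =
        (1 - p) ^ card T * ((\<Prod>e\<in>E. p) * (\<Prod>e\<in>(?U - T) - E. 1 - p))"
      by (simp add: power_add)
  qed
  \<comment> \<open>The sum over subsets is the expansion of a product of factors
    \<open>p + (1 - p)\<close>, each equal to 1.\<close>
  also have "\<dots> = (1 - p) ^ card T * (\<Prod>e\<in>?U - T. p + (1 - p))"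
    using fin by (subst prod_add) (auto simp: sum_distrib_left)
  finally show ?thesis by simp
qed

section \<open>The lower tail of the number of edges in a set of pairs\<close>

lemma card_subsets_le:
  assumes "finite T"
  shows "card {W. W \<subseteq> T \<and> card W \<le> m} \<le> (card T + 1) ^ m"
proof (induction m)
  case 0
  have "{W. W \<subseteq> T \<and> card W \<le> 0} = {{}}" using finite_subset[OF _ assms] by auto
  then show ?case by simp
next
  case (Suc m)
  let ?D = "{W. W \<subseteq> T \<and> card W \<le> m} \<times> insert None (Some ` T)"
  \<comment> \<open>A set of size at most \<open>Suc m\<close> is a set of size at most
    \<open>m\<close> with one element adjoined, or with nothing adjoined (\<open>None\<close>); this
    costs a factor \<open>card T + 1\<close>.\<close>
  let ?g = "\<lambda>(W, z). case z of None \<Rightarrow> W | Some x \<Rightarrow> insert x W"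
  have fin: "finite {W. W \<subseteq> T \<and> card W \<le> m}"
    by (rule finite_subset[of _ "Pow T"]) (use assms in auto)
  have "{W. W \<subseteq> T \<and> card W \<le> Suc m} \<subseteq> ?g ` ?D"
  proof
    fix W assume W: "W \<in> {W. W \<subseteq> T \<and> card W \<le> Suc m}"
    show "W \<in> ?g ` ?D"
    proof (cases "W = {}")
      case True
      then show ?thesis by (intro image_eqI[of _ _ "({}, None)"]) auto
    next
      case False
      then obtain x where "x \<in> W" by auto
      moreover have "finite W" using W assms finite_subset by auto
      ultimately have "W = ?g (W - {x}, Some x)" "(W - {x}, Some x) \<in> ?D" using W by auto
      then show ?thesis by blast
    qed
  qed
  then have "card {W. W \<subseteq> T \<and> card W \<le> Suc m} \<le> card ?D"
    using fin assms by (intro surj_card_le) auto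
  also have "\<dots> = card {W. W \<subseteq> T \<and> card W \<le> m} * (card T + 1)"
    using assms by (simp add: card_cartesian_product card_insert_if card_image)
  also have "\<dots> \<le> (card T + 1) ^ m * (card T + 1)" by (rule mult_le_mono1[OF Suc.IH])
  finally show ?case by (simp add: mult.commute)
qed

text \<open>If few elements of \<open>T\<close> are edges, let \<open>W\<close> be the set of those:
  then \<open>E\<close> avoids \<open>T - W\<close>, which has at least \<open>card T - m\<close>
  elements. The first factor bounds the number of choices for \<open>W\<close>.\<close>

lemma gnp_prob_few_edges_le:
  assumes "0 \<le> p" "p \<le> 1" "T \<subseteq> all_edges n"
  shows "gnp_prob n p (\<lambda>E. card (E \<inter> T) < m) \<le> real (card T + 1) ^ m * (1 - p) ^ (card T - m)"
proof -
  let ?I = "{W. W \<subseteq> T \<and> card W \<le> m}"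
  have T: "finite T" using finite_subset[OF assms(3)] by simp
  then have I: "finite ?I" by (auto intro: finite_subset[of _ "Pow T"])
  have "gnp_prob n p (\<lambda>E. card (E \<inter> T) < m) \<le> gnp_prob n p (\<lambda>E. \<exists>W\<in>?I. E \<inter> (T - W) = {})"
    using assms(1,2) by (rule gnp_prob_mono) (auto intro!: exI[of _ "_ \<inter> T"])
  also have "\<dots> \<le> (\<Sum>W\<in>?I. gnp_prob n p (\<lambda>E. E \<inter> (T - W) = {}))"
    using assms I by (intro gnp_prob_Bex_le) auto
  also have "\<dots> = (\<Sum>W\<in>?I. (1 - p) ^ card (T - W))"
    using assms by (intro sum.cong refl gnp_prob_avoid) auto
  also have "\<dots> \<le> (\<Sum>W\<in>?I. (1 - p) ^ (card T - m))"
    using assms T finite_subset[OF _ T]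
    by (intro sum_mono power_decreasing) (auto simp: card_Diff_subset)
  also have "\<dots> = real (card ?I) * (1 - p) ^ (card T - m)" by simp
  also have "\<dots> \<le> real ((card T + 1) ^ m) * (1 - p) ^ (card T - m)"
    using card_subsets_le[OF T, of m] assms by (intro mult_right_mono) (simp_all only: of_nat_le_iff zero_le_power diff_ge_0_iff_ge)
  finally show ?thesis by simp
qed

lemma gnp_prob_few_edges_le':
  assumes "0 \<le> p" "p \<le> 1" "T \<subseteq> all_edges n" "t \<le> card T" "n \<ge> 1"
  shows "gnp_prob n p (\<lambda>E. card (E \<inter> T) < m) \<le> (real n ^ 2) ^ m * (1 - p) ^ (t - m)"
proof -
  have "card T \<le> n * (n - 1) div 2"
    using card_mono[OF finite_all_edges assms(3)] by (simp add: card_all_edges choose_two)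
  also have "\<dots> \<le> n * (n - 1)" by (rule div_le_dividend)
  finally have "card T + 1 \<le> n\<^sup>2"
    using \<open>n \<ge> 1\<close> by (cases n) (auto simp: power2_eq_square)
  then have "real (card T + 1) \<le> real n ^ 2" by (metis of_nat_le_iff of_nat_power)
  then have "real (card T + 1) ^ m * (1 - p) ^ (card T - m) \<le> (real n ^ 2) ^ m * (1 - p) ^ (t - m)"
    using assms by (intro mult_mono power_mono power_decreasing) auto
  then show ?thesis using gnp_prob_few_edges_le[OF assms(1-3), of m] by linarith
qed

section \<open>The union bound over all obstructions\<close>

lemma card_subsets_eq_le_pow: "card {A. A \<subseteq> {0..<n} \<and> card A = a} \<le> n ^ a"
  using binomial_le_pow[of a n] by (cases "a \<le> n") (auto simp: n_subsets binomial_eq_0)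

text \<open>The first summand is for sparse \<open>k\<close>-sets. In the second, a sparse pair
  \<open>A\<close>, \<open>B\<close> is encoded by \<open>A\<close> of size \<open>a\<close> and the
  set \<open>S\<close> of missing vertices, with \<open>B\<close> the rest: \<open>n ^ a\<close>
  bounds the choices of \<open>A\<close>, \<open>(n ^ 2) ^ k\<close> those of \<open>S\<close>, and
  the other power of \<open>n ^ 2\<close> the choices of the few edges present.\<close>

lemma gnp_prob_no_edge_disjoint_ham_le:
  assumes p: "0 \<le> p" "p \<le> 1" and n: "n \<ge> 3" and k: "k \<ge> 1"
  shows "gnp_prob n p (\<lambda>E. \<not> has_r_edge_disjoint_ham n r E) \<le>
     real n ^ k * (real n ^ 2) ^ (2 * r * k) * (1 - p) ^ ((k choose 2) - 2 * r * k) +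
     (\<Sum>a\<in>{1..n div 2}. real n ^ a * (real n ^ 2) ^ k * (real n ^ 2) ^ (2 * r * a) *
        (1 - p) ^ (a * (n - a - k) - 2 * r * a))"
proof -
  let ?V = "{0..<n}"
  define \<K> where "\<K> = {K. K \<subseteq> ?V \<and> card K = k}"
  define \<A> where "\<A> = (\<lambda>a. {A. A \<subseteq> ?V \<and> card A = a} \<times> {S. S \<subseteq> ?V \<and> card S \<le> k})"
  define F where "F = (\<lambda>(K :: nat set) E. card (E \<inter> {e. e \<subseteq> K \<and> card e = 2}) < 2 * r * k)"
  define G where "G = (\<lambda>a (A, S) E. card (E \<inter> edges_between A (?V - A - S)) < 2 * r * a)"
  have fin: "finite \<K>" "finite (\<A> a)" for a
    by (auto simp: \<K>_def \<A>_def intro: finite_subset[of _ "Pow ?V"])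
  have "gnp_prob n p (\<lambda>E. \<not> has_r_edge_disjoint_ham n r E) \<le>
      gnp_prob n p (\<lambda>E. (\<exists>K\<in>\<K>. F K E) \<or> (\<exists>a\<in>{1..n div 2}. \<exists>AS\<in>\<A> a. G a AS E))"
  proof (rule gnp_prob_mono[OF p], rule ccontr)
    fix E assume E: "E \<subseteq> all_edges n" and no: "\<not> has_r_edge_disjoint_ham n r E"
      and neg: "\<not> ((\<exists>K\<in>\<K>. F K E) \<or> (\<exists>a\<in>{1..n div 2}. \<exists>AS\<in>\<A> a. G a AS E))"
    have "has_r_edge_disjoint_ham n r E"
    proof (rule edge_disjoint_ham_of_many_edges[OF E n k])
      fix K assume "K \<subseteq> ?V" "card K = k"
      then show "2 * r * k \<le> card (E \<inter> {e. e \<subseteq> K \<and> card e = 2})"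
        using neg by (auto simp: \<K>_def F_def not_less)
    next
      fix A B assume *: "A \<union> B \<subseteq> ?V" "A \<inter> B = {}" "A \<noteq> {}" "card A \<le> card B" "n < card A + card B + k"
      have fAB: "finite A" "finite B" using *(1) by (auto intro: finite_subset)
      have "card (A \<union> B) = card A + card B" using * fAB by (simp add: card_Un_disjoint)
      moreover have "card (A \<union> B) \<le> n" using card_mono[OF _ *(1)] by simp
      \<comment> \<open>As \<open>A\<close> is the smaller of two disjoint sets,
        \<open>2 * card A \<le> n\<close>.\<close>
      ultimately have "card A \<in> {1..n div 2}" using * fAB by (auto simp: Suc_le_eq card_gt_0_iff)
      define S where "S = ?V - (A \<union> B)"
      have "card S = n - (card A + card B)"
        using * fAB by (simp add: S_def card_Diff_subset card_Un_disjoint)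
      then have "(A, S) \<in> \<A> (card A)" using * by (auto simp: \<A>_def S_def)
      moreover have "?V - A - S = B" using * by (auto simp: S_def)
      ultimately show "2 * r * card A \<le> card (E \<inter> edges_between A B)"
        using neg \<open>card A \<in> {1..n div 2}\<close> by (force simp: G_def not_less)
    qed
    then show False using no by simp
  qed
  also have "\<dots> \<le> gnp_prob n p (\<lambda>E. \<exists>K\<in>\<K>. F K E) + gnp_prob n p (\<lambda>E. \<exists>a\<in>{1..n div 2}. \<exists>AS\<in>\<A> a. G a AS E)"
    by (rule gnp_prob_disj_le[OF p])
  also have "\<dots> \<le> (\<Sum>K\<in>\<K>. gnp_prob n p (F K)) + (\<Sum>a\<in>{1..n div 2}. \<Sum>AS\<in>\<A> a. gnp_prob n p (G a AS))"
  proof (intro add_mono gnp_prob_Bex_le p fin)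
    have "gnp_prob n p (\<lambda>E. \<exists>a\<in>{1..n div 2}. \<exists>AS\<in>\<A> a. G a AS E)
        \<le> (\<Sum>a\<in>{1..n div 2}. gnp_prob n p (\<lambda>E. \<exists>AS\<in>\<A> a. G a AS E))"
      by (intro gnp_prob_Bex_le p) auto
    also have "\<dots> \<le> (\<Sum>a\<in>{1..n div 2}. \<Sum>AS\<in>\<A> a. gnp_prob n p (G a AS))"
      by (intro sum_mono gnp_prob_Bex_le p fin)
    finally show "gnp_prob n p (\<lambda>E. \<exists>a\<in>{1..n div 2}. \<exists>AS\<in>\<A> a. G a AS E)
        \<le> (\<Sum>a\<in>{1..n div 2}. \<Sum>AS\<in>\<A> a. gnp_prob n p (G a AS))" .
  qed
  also have "\<dots> \<le> real n ^ k * (real n ^ 2) ^ (2 * r * k) * (1 - p) ^ ((k choose 2) - 2 * r * k) +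
     (\<Sum>a\<in>{1..n div 2}. real n ^ a * (real n ^ 2) ^ k * (real n ^ 2) ^ (2 * r * a) *
        (1 - p) ^ (a * (n - a - k) - 2 * r * a))"
  proof (intro add_mono sum_mono)
    have "(\<Sum>K\<in>\<K>. gnp_prob n p (F K)) \<le>
        (\<Sum>K\<in>\<K>. (real n ^ 2) ^ (2 * r * k) * (1 - p) ^ ((k choose 2) - 2 * r * k))"
    proof (rule sum_mono)
      fix K assume "K \<in> \<K>"
      then have K: "K \<subseteq> ?V" "card K = k" "finite K" by (auto simp: \<K>_def intro: finite_subset)
      then have "k choose 2 \<le> card {e. e \<subseteq> K \<and> card e = 2}" by (simp add: n_subsets)
      moreover have "{e. e \<subseteq> K \<and> card e = 2} \<subseteq> all_edges n" using K by (auto simp: all_edges_def)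
      ultimately show "gnp_prob n p (F K) \<le>
          (real n ^ 2) ^ (2 * r * k) * (1 - p) ^ ((k choose 2) - 2 * r * k)"
        unfolding F_def using p n by (intro gnp_prob_few_edges_le') auto
    qed
    also have "\<dots> = real (card \<K>) * ((real n ^ 2) ^ (2 * r * k) * (1 - p) ^ ((k choose 2) - 2 * r * k))"
      by simp
    also have "\<dots> \<le> real n ^ k * ((real n ^ 2) ^ (2 * r * k) * (1 - p) ^ ((k choose 2) - 2 * r * k))"
    proof (rule mult_right_mono)
      show "real (card \<K>) \<le> real n ^ k"
        using card_subsets_eq_le_pow[of n k] unfolding \<K>_def by (metis of_nat_le_iff of_nat_power)
    qed (use p in auto)
    finally show "(\<Sum>K\<in>\<K>. gnp_prob n p (F K)) \<le>
        real n ^ k * (real n ^ 2) ^ (2 * r * k) * (1 - p) ^ ((k choose 2) - 2 * r * k)"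
      by (simp add: mult.assoc)
  next
    fix a assume "a \<in> {1..n div 2}"
    let ?b = "(real n ^ 2) ^ (2 * r * a) * (1 - p) ^ (a * (n - a - k) - 2 * r * a)"
    have "(\<Sum>AS\<in>\<A> a. gnp_prob n p (G a AS)) \<le> (\<Sum>AS\<in>\<A> a. ?b)"
    proof (rule sum_mono)
      fix AS assume "AS \<in> \<A> a"
      then obtain A S where AS: "AS = (A, S)" "A \<subseteq> ?V" "card A = a" "S \<subseteq> ?V" "card S \<le> k"
        by (auto simp: \<A>_def)
      then have f: "finite A" "finite S" by (auto intro: finite_subset)
      \<comment> \<open>Pairs in \<open>\<A> a\<close> may overlap; the bound on what remains holds
        regardless.\<close>
      have "n - a - card S \<le> card (?V - A - S)"
        using AS f diff_card_le_card_Diff[of S "?V - A"] by (simp add: card_Diff_subset)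
      then have "n - a - k \<le> card (?V - A - S)" using AS by linarith
      then have "a * (n - a - k) \<le> card (edges_between A (?V - A - S))"
        using AS by (subst card_edges_between) auto
      moreover have "edges_between A (?V - A - S) \<subseteq> all_edges n"
        using AS by (intro edges_between_subset) auto
      ultimately show "gnp_prob n p (G a AS) \<le> ?b"
        unfolding G_def AS prod.case using p n by (intro gnp_prob_few_edges_le') auto
    qed
    also have "\<dots> = real (card (\<A> a)) * ?b" by simp
    also have "\<dots> \<le> (real n ^ a * (real n ^ 2) ^ k) * ?b"
    proof (rule mult_right_mono)
      have "card (\<A> a) \<le> n ^ a * (n + 1) ^ k"
        using card_subsets_eq_le_pow[of n a] card_subsets_le[of ?V k]
        unfolding \<A>_def card_cartesian_product by (intro mult_mono) auto
      also have "\<dots> \<le> n ^ a * (n\<^sup>2) ^ k"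
        using n by (intro mult_mono power_mono) (auto simp: power2_eq_square intro: order_trans[of _ "3 * n"])
      finally show "real (card (\<A> a)) \<le> real n ^ a * (real n ^ 2) ^ k"
        by (metis of_nat_le_iff of_nat_power of_nat_mult)
    qed (use p in auto)
    finally show "(\<Sum>AS\<in>\<A> a. gnp_prob n p (G a AS)) \<le>
       real n ^ a * (real n ^ 2) ^ k * (real n ^ 2) ^ (2 * r * a) * (1 - p) ^ (a * (n - a - k) - 2 * r * a)"
      by (simp add: mult.assoc)
  qed
  finally show ?thesis .
qed

subsection \<open>Asymptotics\<close>

lemma power_conv_exp: "0 < x \<Longrightarrow> x ^ m = exp (real m * ln x)" for x :: real
  by (simp add: exp_of_nat_mult)

lemma real_diff_le_real_diff: "real a - real b \<le> real (a - b)"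
  by linarith

text \<open>With \<open>q = - ln (1 - p)\<close> and \<open>D = q * n\<close>, the target
  \<open>(1 - p) ^ n\<close> is \<open>exp (- D)\<close>. Since \<open>p \<le> q\<close>, the
  assumption \<open>rL\<close> bounds the logarithms of all counting factors by small multiples of
  \<open>\<theta> * D\<close>, scaled by \<open>a\<close> in the summand for
  \<open>a\<close>.\<close>

lemma gnp_prob_no_edge_disjoint_ham_upper:
  fixes \<theta> p :: real
  assumes p: "0 < p" "p < 1" and n: "n \<ge> 3" and r: "r \<ge> 1" and \<theta>: "0 < \<theta>" "\<theta> \<le> 1 / 100"
    and rL: "real r * ln (real n) \<le> \<theta> * p * sqrt (real n)" and s1: "1 \<le> \<theta> * sqrt (real n)"
  shows "gnp_prob n p (\<lambda>E. \<not> has_r_edge_disjoint_ham n r E) \<le> exp ((1 - 22 * \<theta>) * real n * ln (1 - p))"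
proof -
  define L where "L = ln (real n)"
  define q where "q = - ln (1 - p)"
  define s where "s = sqrt (real n)"
  define D where "D = q * real n"
  have ss: "s * s = real n" by (simp add: s_def)
  have "p \<le> q" using ln_le_minus_one[of "1 - p"] p by (simp add: q_def)
  have q: "q > 0" using \<open>p \<le> q\<close> p by simp
  have s: "s \<ge> 100"
  proof -
    have "1 \<le> \<theta> * s" using s1 by (simp add: s_def)
    also have "\<dots> \<le> 1 / 100 * s" using \<theta> by (intro mult_right_mono) (auto simp: s_def)
    finally show ?thesis by simp
  qed
  have sn: "s \<le> \<theta> * real n"
    using mult_right_mono[OF s1, of s] ss s by (simp add: s_def mult.assoc)
  have \<theta>n: "1 \<le> \<theta> * real n" using sn s by simp
  have s_le: "s \<le> real n" using ss s mult_right_mono[of 1 s s] by simp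
  have L: "1 \<le> L"
  proof -
    have "exp 1 \<le> real n" using exp_le n by simp
    then show ?thesis unfolding L_def using n by (subst ln_ge_iff) auto
  qed
  have rLq: "real r * L \<le> \<theta> * q * s"
  proof -
    have "\<theta> * p * s \<le> \<theta> * q * s" using \<open>p \<le> q\<close> \<theta> s by (intro mult_right_mono mult_left_mono) auto
    then show ?thesis using rL by (simp add: L_def s_def)
  qed
  have rs: "real r \<le> \<theta> * s"
  proof -
    have "real r * 1 \<le> real r * L" using L by (intro mult_left_mono) auto
    also have "\<dots> \<le> \<theta> * p * s" using rL by (simp add: L_def s_def)
    also have "\<dots> \<le> \<theta> * 1 * s" using p \<theta> s by (intro mult_mono) auto
    finally show ?thesis by simp
  qed
  have LrL: "L \<le> real r * L" using L r by simp
  have LD: "L \<le> \<theta> * D"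
  proof -
    have "L \<le> \<theta> * q * s" using LrL rLq by simp
    also have "\<dots> \<le> \<theta> * q * real n" using s_le q \<theta> by (intro mult_left_mono) auto
    finally show ?thesis by (simp add: D_def)
  qed
  \<comment> \<open>The factor 3 gives \<open>k choose 2 \<ge> 3 * n\<close>, well above the
    \<open>n\<close> needed; rounding up stays below \<open>4 * s\<close> because \<open>s\<close>
    is large.\<close>
  define k where "k = nat \<lceil>3 * s\<rceil>"
  have k: "3 * s \<le> real k" "real k \<le> 4 * s" "k \<ge> 1"
    using s unfolding k_def by linarith+
  have base: "real n > 0" "1 - p > 0" using n p by auto
  let ?T1 = "real n ^ k * (real n ^ 2) ^ (2 * r * k) * (1 - p) ^ ((k choose 2) - 2 * r * k)"
  let ?T2 = "\<lambda>a. real n ^ a * (real n ^ 2) ^ k * (real n ^ 2) ^ (2 * r * a) *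
        (1 - p) ^ (a * (n - a - k) - 2 * r * a)"
  \<comment> \<open>This fixes the scale of the hypothesis: \<open>k\<close> and
    \<open>r * L\<close> each contribute a factor \<open>s\<close>, and \<open>s * s = n\<close>
    turns the product into a multiple of \<open>D\<close>.\<close>
  have krL: "real k * (real r * L) \<le> 4 * (\<theta> * D)"
  proof -
    have "real k * (real r * L) \<le> (4 * s) * (\<theta> * q * s)"
      using s L by (intro mult_mono[OF k(2) rLq]) auto
    also have "\<dots> = 4 * \<theta> * q * (s * s)" by simp
    finally show ?thesis by (simp add: ss D_def)
  qed
  have T1: "?T1 \<le> exp (- D)"
  proof -
    have choose: "3 * real n \<le> real (k choose 2)"
    proof -
      have "real (k choose 2) = real k * (real k - 1) / 2"
        using k by (simp add: choose_two real_of_nat_div of_nat_diff)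
      moreover have "(3 * s) * (3 * s - 1) \<le> real k * (real k - 1)"
        using k s by (intro mult_mono) auto
      moreover have "(3 * s) * (3 * s - 1) = 9 * real n - 3 * s" using ss by (simp add: algebra_simps)
      ultimately show ?thesis using s_le by linarith
    qed
    have rkq: "q * (2 * real r * real k) \<le> 8 * (\<theta> * D)"
    proof -
      have "real r * real k \<le> (\<theta> * s) * (4 * s)" using s \<theta> by (intro mult_mono[OF rs k(2)]) auto
      also have "\<dots> = 4 * \<theta> * (s * s)" by simp
      finally have "q * (real r * real k) \<le> q * (4 * \<theta> * real n)" using q ss by simp
      then show ?thesis by (simp add: D_def algebra_simps)
    qed
    have "real (k choose 2) - 2 * real r * real k \<le> real ((k choose 2) - 2 * r * k)"
      using real_diff_le_real_diff[of "k choose 2" "2 * r * k"] by simp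
    then have "q * (real (k choose 2) - 2 * real r * real k) \<le> q * real ((k choose 2) - 2 * r * k)"
      using q by (intro mult_left_mono) auto
    moreover have "q * (3 * real n) \<le> q * real (k choose 2)" using choose q by (intro mult_left_mono) auto
    ultimately have pw: "3 * D - 8 * (\<theta> * D) \<le> q * real ((k choose 2) - 2 * r * k)"
      using rkq by (simp add: D_def algebra_simps)
    have "?T1 = exp (real k * L + 4 * (real k * (real r * L)) - q * real ((k choose 2) - 2 * r * k))"
      using base by (simp add: power_conv_exp ln_realpow L_def q_def algebra_simps flip: exp_add)
    \<comment> \<open>The error terms are \<open>4 + 16 + 8 = 28\<close> times
      \<open>\<theta> * D\<close>, far less than the slack \<open>2 * D\<close>.\<close>
    also have "\<dots> \<le> exp (- D)"
    proof -
      have "real k * L \<le> real k * (real r * L)" using LrL by (intro mult_left_mono) auto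
      moreover have "\<theta> * D \<le> 1 / 100 * D" using \<theta> q by (intro mult_right_mono) (auto simp: D_def)
      moreover have "D \<ge> 0" using q by (simp add: D_def)
      ultimately show ?thesis unfolding exp_le_cancel_iff using krL pw by linarith
    qed
    finally show ?thesis .
  qed
  have T2: "?T2 a \<le> exp (- (1 - 20 * \<theta>) * D)" if a: "a \<in> {1..n div 2}" for a
  proof -
    have a': "1 \<le> real a" "2 * real a \<le> real n" using a by auto
    have D0: "\<theta> * D \<ge> 0" using q \<theta> by (simp add: D_def)
    have e1: "real a * (real r * L) \<le> real a * (\<theta> * D)"
    proof (intro mult_left_mono)
      have "\<theta> * q * s \<le> \<theta> * q * real n" using s_le q \<theta> by (intro mult_left_mono) auto
      then show "real r * L \<le> \<theta> * D" using rLq by (simp add: D_def)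
    qed simp
    have e0: "real a * L \<le> real a * (real r * L)" using LrL by (intro mult_left_mono) auto
    \<comment> \<open>The cost of choosing \<open>S\<close> does not grow with \<open>a\<close>; as
      \<open>a \<ge> 1\<close>, it may still be charged to
      \<open>a * (\<theta> * D)\<close>.\<close>
    have e2: "real k * L \<le> 4 * (real a * (\<theta> * D))"
    proof -
      have "real k * L \<le> real k * (real r * L)" using LrL by (intro mult_left_mono) auto
      also have "\<dots> \<le> 4 * (1 * (\<theta> * D))" using krL by simp
      also have "\<dots> \<le> 4 * (real a * (\<theta> * D))" using a' D0 by (intro mult_left_mono mult_right_mono) auto
      finally show ?thesis .
    qed
    have e3: "q * (2 * real r * real a) \<le> 2 * (real a * (\<theta> * D))"
    proof -
      have "real r \<le> \<theta> * real n" using rs mult_left_mono[OF s_le, of \<theta>] \<theta> by linarith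
      then have "q * (2 * real r * real a) \<le> q * (2 * (\<theta> * real n) * real a)"
        using q by (intro mult_left_mono mult_right_mono) auto
      then show ?thesis by (simp add: D_def algebra_simps)
    qed
    have e4: "q * (real a * real k) \<le> 4 * (real a * (\<theta> * D))"
    proof -
      have "real k \<le> 4 * (\<theta> * real n)" using k sn by simp
      then have "q * (real a * real k) \<le> q * (real a * (4 * (\<theta> * real n)))"
        using q by (intro mult_left_mono) auto
      then show ?thesis by (simp add: D_def algebra_simps)
    qed
    have pw: "q * (real a * (real n - real a - real k) - 2 * real r * real a)
        \<le> q * real (a * (n - a - k) - 2 * r * a)"
    proof (rule mult_left_mono)
      have "real n - real a - real k \<le> real (n - a - k)" by linarith
      then have "real a * (real n - real a - real k) \<le> real a * real (n - a - k)"
        by (intro mult_left_mono) auto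
      also have "\<dots> - 2 * real r * real a \<le> real (a * (n - a - k) - 2 * r * a)"
        using real_diff_le_real_diff[of "a * (n - a - k)" "2 * r * a"] by simp
      finally show "real a * (real n - real a - real k) - 2 * real r * real a
          \<le> real (a * (n - a - k) - 2 * r * a)" by simp
    qed (use q in simp)
    \<comment> \<open>The errors in \<open>?T2 a\<close> add up to
      \<open>1 + 8 + 4 + 4 + 2 = 19\<close> times \<open>a * (\<theta> * D)\<close>. The net
      exponent over \<open>q\<close>, \<open>a * (n - a) - 19 * a * \<theta> * n\<close>, equals
      \<open>n - c\<close> at \<open>a = 1\<close> and exceeds this value by
      \<open>(a - 1) * (n - c - a)\<close>, which is nonnegative for \<open>a \<le> n / 2\<close>.
      So \<open>a = 1\<close> is the worst case.\<close>
    define c where "c = 1 + 19 * \<theta> * real n"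
    have c: "c \<le> 20 * (\<theta> * real n)" using \<theta>n by (simp add: c_def)
    have "\<theta> * real n \<le> 1 / 100 * real n" using \<theta> by (intro mult_right_mono) auto
    then have "0 \<le> (real a - 1) * (real n - c - real a)"
      using a' c by (intro mult_nonneg_nonneg) linarith+
    then have "real n - 20 * \<theta> * real n \<le> real a * (real n - real a) - 19 * (real a * (\<theta> * real n))"
      using c by (simp add: c_def algebra_simps)
    then have "q * (real n - 20 * \<theta> * real n) \<le> q * (real a * (real n - real a) - 19 * (real a * (\<theta> * real n)))"
      using q by (intro mult_left_mono) auto
    then have conc: "(1 - 20 * \<theta>) * D \<le> q * (real a * (real n - real a)) - 19 * (real a * (\<theta> * D))"
      by (simp add: D_def algebra_simps)
    have "?T2 a = exp (real a * L + 2 * (real k * L) + 4 * (real a * (real r * L))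
        - q * real (a * (n - a - k) - 2 * r * a))"
      using base by (simp add: power_conv_exp ln_realpow L_def q_def algebra_simps flip: exp_add)
    also have "\<dots> \<le> exp (- (1 - 20 * \<theta>) * D)"
    proof -
      have "q * (real a * (real n - real a - real k) - 2 * real r * real a)
        = q * (real a * (real n - real a)) - q * (real a * real k) - q * (2 * real r * real a)"
        by (simp add: algebra_simps)
      then have "real a * L + 2 * (real k * L) + 4 * (real a * (real r * L))
        - q * real (a * (n - a - k) - 2 * r * a) \<le> - ((1 - 20 * \<theta>) * D)"
        using e0 e1 e2 e3 e4 pw conc by linarith
      then show ?thesis unfolding exp_le_cancel_iff mult_minus_left .
    qed
    finally show ?thesis .
  qed
  have "gnp_prob n p (\<lambda>E. \<not> has_r_edge_disjoint_ham n r E) \<le> ?T1 + (\<Sum>a\<in>{1..n div 2}. ?T2 a)"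
    using p n k by (intro gnp_prob_no_edge_disjoint_ham_le) auto
  also have "\<dots> \<le> exp (- D) + (\<Sum>a\<in>{1..n div 2}. exp (- (1 - 20 * \<theta>) * D))"
    by (intro add_mono T1 sum_mono T2)
  also have "\<dots> = exp (- D) + real (n div 2) * exp (- (1 - 20 * \<theta>) * D)" by simp
  \<comment> \<open>In total at most \<open>n = exp L\<close> copies of one bound, and
    \<open>L \<le> \<theta> * D\<close> is absorbed by passing from 20 to 22.\<close>
  also have "\<dots> \<le> exp (- (1 - 20 * \<theta>) * D) + (real n - 1) * exp (- (1 - 20 * \<theta>) * D)"
  proof (intro add_mono mult_right_mono)
    have "0 \<le> \<theta> * D" using q \<theta> by (simp add: D_def)
    then show "exp (- D) \<le> exp (- (1 - 20 * \<theta>) * D)" by (simp add: algebra_simps)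
  qed (use n in auto)
  also have "\<dots> = exp L * exp (- (1 - 20 * \<theta>) * D)"
    using n by (simp add: L_def left_diff_distrib)
  also have "\<dots> = exp (L + - (1 - 20 * \<theta>) * D)" by (rule exp_add[symmetric])
  also have "\<dots> \<le> exp (- (1 - 22 * \<theta>) * D)"
  proof -
    have "\<theta> * D \<ge> 0" using q \<theta> by (simp add: D_def)
    then show ?thesis using LD by (simp add: algebra_simps)
  qed
  also have "- (1 - 22 * \<theta>) * D = (1 - 22 * \<theta>) * real n * ln (1 - p)" by (simp add: D_def q_def algebra_simps)
  finally show ?thesis .
qed

section \<open>The lower bound from an isolated vertex\<close>

text \<open>At most \<open>n\<close> pairs contain the vertex 0. If none of them is an edge, there
  is no Hamilton cycle, since it would need an edge at 0; \<open>r \<ge> 1\<close> asks for at least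
  one.\<close>

lemma gnp_prob_no_edge_disjoint_ham_lower:
  assumes p: "0 \<le> p" "p \<le> 1" and r: "r \<ge> 1"
  shows "(1 - p) ^ n \<le> gnp_prob n p (\<lambda>E. \<not> has_r_edge_disjoint_ham n r E)"
proof -
  define T where "T = {e \<in> all_edges n. 0 \<in> e}"
  have "T \<subseteq> (\<lambda>v. {0, v}) ` {0..<n}"
  proof
    fix e assume "e \<in> T"
    then obtain x y where "e = {x, y}" "0 \<in> {x, y}" "x < n" "y < n"
      by (auto simp: T_def all_edges_def card_2_iff)
    then show "e \<in> (\<lambda>v. {0, v}) ` {0..<n}" by (auto simp: insert_commute)
  qed
  then have "card T \<le> n" by (metis card_atLeastLessThan diff_zero finite_atLeastLessThan surj_card_le)
  then have "(1 - p) ^ n \<le> (1 - p) ^ card T" using p by (intro power_decreasing) auto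
  also have "\<dots> = gnp_prob n p (\<lambda>E. E \<inter> T = {})" by (rule gnp_prob_avoid[symmetric]) (auto simp: T_def)
  also have "\<dots> \<le> gnp_prob n p (\<lambda>E. \<not> has_r_edge_disjoint_ham n r E)"
  proof (rule gnp_prob_mono[OF p], rule notI)
    fix E assume E: "E \<subseteq> all_edges n" "E \<inter> T = {}" "has_r_edge_disjoint_ham n r E"
    then obtain H where H: "is_ham_cycle n H" "H \<subseteq> E"
      using r by (auto simp: has_r_edge_disjoint_ham_def)
    then obtain vs where vs: "set vs = {0..<n}" "distinct vs" "n \<ge> 3"
      "H = {{vs ! i, vs ! ((i + 1) mod n)} | i. i < n}" by (auto simp: is_ham_cycle_def)
    moreover have "length vs = n" using vs distinct_card by fastforce
    moreover have "0 \<in> set vs" using vs by simp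
    ultimately obtain i where "i < n" "vs ! i = 0" by (metis in_set_conv_nth)
    then have "{0, vs ! ((i + 1) mod n)} \<in> H" unfolding vs(4) by (intro CollectI exI[of _ i]) auto
    then have "{0, vs ! ((i + 1) mod n)} \<in> E \<inter> T" using E(1) H(2) by (auto simp: T_def)
    then show False using E(2) by simp
  qed
  finally show ?thesis .
qed

section \<open>Comparison of the two bounds on the logarithmic scale\<close>

theorem theorem6:
  fixes \<epsilon> :: real and p :: "nat \<Rightarrow> real" and r :: "nat \<Rightarrow> nat"
  assumes "0 < \<epsilon>" and "\<epsilon> < 1"
    and "\<And>n. 0 \<le> p n" and "\<And>n. p n \<le> 1 - \<epsilon>"
    and "\<And>n. 0 < r n"
    and "filterlim (\<lambda>n. p n * sqrt (real n) / (real (r n) * ln (real n))) at_top sequentially"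
  shows "\<exists>\<delta> :: nat \<Rightarrow> real. \<delta> \<longlonglongrightarrow> 0 \<and>
           (\<forall>\<^sub>F n in sequentially.
              gnp_prob n (p n) (\<lambda>E. \<not> has_r_edge_disjoint_ham n (r n) E)
                = (1 - p n) powr ((1 + \<delta> n) * real n))"
proof -
  define F where "F = (\<lambda>n. gnp_prob n (p n) (\<lambda>E. \<not> has_r_edge_disjoint_ham n (r n) E))"
  \<comment> \<open>Obtained by solving the claimed identity for the exponent. It is meaningful when
    \<open>p n > 0\<close>, that is, when the logarithm in the denominator is nonzero.\<close>
  define \<delta> where "\<delta> = (\<lambda>n. ln (F n) / (real n * ln (1 - p n)) - 1)"
  have p1: "p n < 1" for n using assms(1) assms(4)[of n] by linarith
  have lower: "(1 - p n) ^ n \<le> F n" for n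
    unfolding F_def using assms(3,5) p1[of n]
    by (intro gnp_prob_no_edge_disjoint_ham_lower) (auto simp: Suc_le_eq)
  then have Fpos: "F n > 0" for n using p1[of n] less_le_trans[of 0 "(1 - p n) ^ n"] by simp
  \<comment> \<open>Where \<open>p n = 0\<close> the diverging quotient is 0, so this happens for
    only finitely many \<open>n\<close>.\<close>
  have ppos: "\<forall>\<^sub>F n in sequentially. 0 < p n"
    using filterlim_at_top_dense[THEN iffD1, OF assms(6), rule_format, of 0]
  proof eventually_elim
    case (elim n)
    then show ?case using assms(3)[of n] by (cases "p n = 0") auto
  qed
  have "\<delta> \<longlonglongrightarrow> 0"
  proof (rule LIMSEQ_I)
    fix \<eta> :: real assume "0 < \<eta>"
    \<comment> \<open>The divisor 23 makes \<open>22 * \<theta>\<close> strictly smaller than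
      \<open>\<eta>\<close>; the cap \<open>1 / 100\<close> is what the upper bound
      requires.\<close>
    define \<theta> where "\<theta> = min (1 / 100) (\<eta> / 23)"
    have \<theta>: "0 < \<theta>" "\<theta> \<le> 1 / 100" "22 * \<theta> < \<eta>" using \<open>0 < \<eta>\<close> by (auto simp: \<theta>_def min_def)
    have "filterlim (\<lambda>n. sqrt (real n)) at_top sequentially"
      by (rule filterlim_compose[OF sqrt_at_top filterlim_real_sequentially])
    then have "\<forall>\<^sub>F n in sequentially. 1 / \<theta> \<le> sqrt (real n)" by (simp add: filterlim_at_top)
    moreover have "\<forall>\<^sub>F n in sequentially. 1 / \<theta> \<le> p n * sqrt (real n) / (real (r n) * ln (real n))"
      using assms(6) by (simp add: filterlim_at_top)
    moreover have "\<forall>\<^sub>F n in sequentially. n \<ge> 3" by (rule eventually_ge_at_top)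
    ultimately have "\<forall>\<^sub>F n in sequentially. norm (\<delta> n - 0) < \<eta>"
      using ppos
    proof eventually_elim
      case (elim n)
      have L: "real (r n) * ln (real n) > 0" using assms(5)[of n] elim by simp
      have "real (r n) * ln (real n) \<le> \<theta> * p n * sqrt (real n)"
        using elim(2) L \<theta> by (simp add: field_simps)
      moreover have "1 \<le> \<theta> * sqrt (real n)" using elim(1) \<theta> by (simp add: field_simps)
      ultimately have upper: "F n \<le> exp ((1 - 22 * \<theta>) * real n * ln (1 - p n))"
        unfolding F_def using elim \<theta> p1[of n] assms(5)[of n]
        by (intro gnp_prob_no_edge_disjoint_ham_upper) auto
      \<comment> \<open>Dividing by the negative \<open>M\<close> reverses both bounds on
        \<open>ln (F n)\<close>, so \<open>\<delta> n\<close> lies between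
        \<open>- 22 * \<theta>\<close> and 0.\<close>
      define M where "M = real n * ln (1 - p n)"
      have M: "M < 0" using elim p1[of n] by (simp add: M_def mult_pos_neg)
      have "ln (F n) \<le> (1 - 22 * \<theta>) * M"
        using ln_mono[OF upper Fpos[of n]] by (simp add: M_def mult.assoc)
      then have "1 - 22 * \<theta> \<le> ln (F n) / M" using M by (simp add: field_simps)
      moreover have "M \<le> ln (F n)"
      proof -
        have "M = ln ((1 - p n) ^ n)" using p1[of n] by (simp add: M_def ln_realpow)
        then show ?thesis using lower[of n] p1[of n] Fpos[of n] by simp
      qed
      then have "ln (F n) / M \<le> 1" using M by (simp add: field_simps)
      ultimately show ?case using \<theta> by (simp add: \<delta>_def M_def[symmetric])
    qed
    then show "\<exists>N. \<forall>n\<ge>N. norm (\<delta> n - 0) < \<eta>" by (simp add: eventually_sequentially)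
  qed
  moreover have "\<forall>\<^sub>F n in sequentially. F n = (1 - p n) powr ((1 + \<delta> n) * real n)"
    using ppos eventually_gt_at_top[of 0]
  proof eventually_elim
    case (elim n)
    have "ln (1 - p n) \<noteq> 0" using elim p1[of n] by simp
    then have "(1 + \<delta> n) * real n * ln (1 - p n) = ln (F n)" using elim by (simp add: \<delta>_def)
    then show ?case using p1[of n] Fpos[of n] by (simp add: powr_def)
  qed
  ultimately show ?thesis unfolding F_def by blast
qed

end
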